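(* Let $S$ be a non-negative random variable whose distribution function $F$ has upper endpoint equal to $1$, and let $X$ be a standard normal $N(0,1)$ random variable independent of $S$. Let $S_n, n\ge 1$ be independent copies of $S$ and $X_n, n\ge 1$ independent $N(0,1)$ random variables, the sequences $(S_n)$ and $(X_n)$ being mutually independent. Let $G$ denote the distribution function of $SX$ and $G^{-1}$ its generalised inverse, and set $$b_n=G^{-1}(1-1/n),\qquad a_n=1/b_n .$$ Then, with $M_n^*=\max_{1\le i\le n} S_iX_i$, $$\lim_{n\to\infty}\sup_{x\in\mathbb{R}}\left|P\left(M_n^*\le a_nx+b_n\right)-\Lambda(x)\right|=0,$$ where $\Lambda(x)=\exp(-\exp(-x))$, $x\in\mathbb{R}$, is the Gumbel distribution function. Moreover $a_n\sim(2\ln n)^{-1/2}$ as $n\to\infty$.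
   Context: $a_n\sim c_n$ means $a_n/c_n\to1$ as $n\to\infty$. *)

theory Defs
  imports "HOL-Probability.Probability"
begin

definition upper_endpoint :: "(real \<Rightarrow> real) \<Rightarrow> ereal" where
  "upper_endpoint F = Sup {ereal x | x. F x < 1}"

definition gen_inv :: "(real \<Rightarrow> real) \<Rightarrow> real \<Rightarrow> real" where
  "gen_inv G p = Inf {x. p \<le> G x}"

definition Gumbel :: "real \<Rightarrow> real" where
  "Gumbel x = exp (- exp (- x))"

end

theory Submission
  imports Defs "HOL-Real_Asymp.Real_Asymp"
begin

text \<open>
  Conditioning on \<open>S\<close> writes the tail \<open>H t = P(S X > t)\<close> as the mixture of the normal tails
  \<open>Q(t / s)\<close> over the law of \<open>S\<close>. Since \<open>S\<close> charges every interval \<open>(c, 1]\<close>, the scales below any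
  \<open>c < 1\<close> contribute negligibly, and Mills' bounds give \<open>H (t + x / t) / H t \<rightarrow> exp (- x / s\<^sup>2)\<close> up to an
  arbitrarily small error for the remaining \<open>s \<approx> 1\<close>; hence the limit \<open>exp (- x)\<close>. They also give
  \<open>ln (H t) \<sim> - t\<^sup>2 / 2\<close>. The limit relation forces \<open>n H (b\<^sub>n) \<rightarrow> 1\<close> (without assuming \<open>G\<close> continuous), so
  \<open>G (b\<^sub>n + x / b\<^sub>n) ^ n = (1 - H (b\<^sub>n + x / b\<^sub>n)) ^ n\<close> tends to \<open>exp (- exp (- x))\<close>; pointwise
  convergence of monotone functions to a continuous distribution function is uniform.
\<close>

subsection \<open>Mills' bounds for the normal tail\<close>

abbreviation std_normal :: "real measure" where
  "std_normal \<equiv> density lborel (\<lambda>x. ennreal (std_normal_density x))"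

interpretation std_normal: prob_space std_normal
  by (rule prob_space_normal_density) simp

definition normal_tail :: "real \<Rightarrow> real" where
  "normal_tail t = measure std_normal {t<..}"

text \<open>The closed half-line is the domain on which the fundamental theorem of calculus is
  applied below; its endpoint is Lebesgue-null.\<close>

lemma nn_integral_normal_tail:
  "(\<integral>\<^sup>+x. ennreal (std_normal_density x) * indicator {t..} x \<partial>lborel) = ennreal (normal_tail t)"
proof -
  have "(\<integral>\<^sup>+x. ennreal (std_normal_density x) * indicator {t..} x \<partial>lborel)
      = (\<integral>\<^sup>+x. ennreal (std_normal_density x) * indicator {t<..} x \<partial>lborel)"
    using AE_lborel_singleton[of t]
    by (intro nn_integral_cong_AE) (auto split: split_indicator)
  also have "\<dots> = emeasure std_normal {t<..}"
    by (subst emeasure_density) auto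
  finally show ?thesis
    by (simp add: normal_tail_def std_normal.emeasure_eq_measure)
qed

text \<open>The density phi satisfies phi'(x) = - x phi(x), so - phi(x) / x is an antiderivative of
  the integrand. This exact value yields both Mills bounds, because 1 <= 1 + 1/x^2 <= 1 + 1/t^2 on
  the half-line from t.\<close>

lemma nn_integral_mills:
  fixes t :: real
  assumes "0 < t"
  shows "(\<integral>\<^sup>+x. ennreal (std_normal_density x * (1 + 1 / x\<^sup>2)) * indicator {t..} x \<partial>lborel)
       = ennreal (std_normal_density t / t)"
proof -
  have "(\<integral>\<^sup>+x. ennreal (std_normal_density x * (1 + 1 / x\<^sup>2)) * indicator {t..} x \<partial>lborel)
       = ennreal (0 - (- (std_normal_density t / t)))"
  proof (rule nn_integral_FTC_atLeast)
    fix x assume "t \<le> x"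
    then have "x \<noteq> 0" using assms by auto
    \<comment> \<open>The factor 1 / sqrt (2 pi) is generalised to an arbitrary \<open>k\<close>,
      which keeps the square root out of the derivative computation.\<close>
    then have "((\<lambda>x. - (k * exp (- x\<^sup>2 / 2) / x)) has_real_derivative
        k * exp (- x\<^sup>2 / 2) * (1 + 1 / x\<^sup>2)) (at x)" for k :: real
      by (auto intro!: derivative_eq_intros simp: field_simps power2_eq_square)
    then show "((\<lambda>x. - (std_normal_density x / x)) has_real_derivative
        std_normal_density x * (1 + 1 / x\<^sup>2)) (at x)"
      unfolding std_normal_density_def .
  next
    show "((\<lambda>x. - (std_normal_density x / x)) \<longlongrightarrow> 0) at_top"
      unfolding std_normal_density_def by real_asymp
  qed auto
  then show ?thesis by simp
qed

lemma normal_tail_upper: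
  assumes "0 < t"
  shows "normal_tail t \<le> std_normal_density t / t"
proof -
  have "ennreal (normal_tail t) \<le> ennreal (std_normal_density t / t)"
    unfolding nn_integral_normal_tail[symmetric] nn_integral_mills[OF assms, symmetric]
    by (intro nn_integral_mono) (auto split: split_indicator intro!: ennreal_leI simp: field_simps)
  then show ?thesis using assms by (simp add: ennreal_le_iff)
qed

lemma normal_tail_lower:
  assumes "0 < t"
  shows "std_normal_density t / t \<le> (1 + 1 / t\<^sup>2) * normal_tail t"
proof -
  have "ennreal (std_normal_density t / t) \<le>
     (\<integral>\<^sup>+x. ennreal (1 + 1 / t\<^sup>2) * (ennreal (std_normal_density x) * indicator {t..} x) \<partial>lborel)"
    unfolding nn_integral_mills[OF assms, symmetric]
  proof (intro nn_integral_mono)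
    fix x :: real
    have "1 + 1 / x\<^sup>2 \<le> 1 + 1 / t\<^sup>2" if "t \<le> x"
      using that assms by (simp add: frac_le power_mono)
    then show "ennreal (std_normal_density x * (1 + 1 / x\<^sup>2)) * indicator {t..} x
       \<le> ennreal (1 + 1 / t\<^sup>2) * (ennreal (std_normal_density x) * indicator {t..} x)"
      by (auto split: split_indicator intro!: ennreal_leI mult_left_mono
          simp: ennreal_mult[symmetric] mult.commute[of "1 + 1 / t\<^sup>2"] simp del: ennreal_plus)
  qed
  also have "\<dots> = ennreal (1 + 1 / t\<^sup>2) * ennreal (normal_tail t)"
    by (subst nn_integral_cmult) (auto simp: nn_integral_normal_tail)
  also have "\<dots> = ennreal ((1 + 1 / t\<^sup>2) * normal_tail t)"
    by (rule ennreal_mult[symmetric]) (auto simp: normal_tail_def)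
  finally show ?thesis by (simp add: ennreal_le_iff normal_tail_def)
qed

lemma normal_tail_nonneg: "0 \<le> normal_tail t"
  by (simp add: normal_tail_def)

lemma normal_tail_pos:
  assumes "0 < t"
  shows "0 < normal_tail t"
proof -
  have "0 < std_normal_density t / t" using assms by (simp add: normal_density_pos)
  also have "\<dots> \<le> (1 + 1 / t\<^sup>2) * normal_tail t" by (rule normal_tail_lower[OF assms])
  finally show ?thesis
    using normal_tail_nonneg[of t] by (cases "normal_tail t = 0") auto
qed

lemma normal_tail_le_1: "normal_tail t \<le> 1"
  by (simp add: normal_tail_def)

lemma normal_tail_antimono: "s \<le> t \<Longrightarrow> normal_tail t \<le> normal_tail s"
  unfolding normal_tail_def by (intro std_normal.finite_measure_mono) auto

lemma borel_measurable_normal_tail [measurable]: "normal_tail \<in> borel_measurable borel"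
proof -
  have "(\<lambda>t. - normal_tail t) \<in> borel_measurable borel"
    by (intro borel_measurable_mono monoI) (simp add: normal_tail_antimono)
  then show ?thesis by (simp add: borel_measurable_uminus_eq)
qed

text \<open>The upper Mills bound at \<open>v\<close> meets the lower one at \<open>u\<close>; the
  exponential is the quotient of the densities. No order between \<open>u\<close> and
  \<open>v\<close> is assumed, so the estimate serves in both directions. Dividing both arguments by
  a scale s leaves u / v unchanged.\<close>

lemma normal_tail_comparison:
  assumes "0 < u" "0 < v"
  shows "normal_tail v \<le> exp ((u\<^sup>2 - v\<^sup>2) / 2) * (u / v) * (1 + 1 / u\<^sup>2) * normal_tail u"
proof -
  have "normal_tail v \<le> std_normal_density v / v"
    by (rule normal_tail_upper) fact
  also have "\<dots> = exp ((u\<^sup>2 - v\<^sup>2) / 2) * (u / v) * (std_normal_density u / u)"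
    using assms by (simp add: std_normal_density_def mult_exp_exp diff_divide_distrib)
  also have "\<dots> \<le> exp ((u\<^sup>2 - v\<^sup>2) / 2) * (u / v) * ((1 + 1 / u\<^sup>2) * normal_tail u)"
    using assms by (intro mult_left_mono normal_tail_lower) auto
  finally show ?thesis by (simp add: mult.assoc)
qed

subsection \<open>Tails of Gaussian scale mixtures\<close>

text \<open>The two assumptions are what upper endpoint 1 says about the law of the scale S: no mass
  beyond 1, but mass arbitrarily close to 1.\<close>

locale gaussian_mixture = real_distribution \<mu> for \<mu> :: "real measure" +
  assumes scale_le_1: "AE s in \<mu>. s \<le> 1"
    and mass_near_1: "\<And>c. c < 1 \<Longrightarrow> 0 < measure \<mu> {c<..}"
begin

text \<open>For 0 <= c and 0 < t this is the contribution to P(S X > t) of the scales above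
  \<open>c\<close>. For a non-negative S, cutoff 0 gives the whole probability, since the scale 0
  never exceeds a positive level.\<close>

definition mix_tail :: "real \<Rightarrow> real \<Rightarrow> real" where
  "mix_tail c t = (\<integral>s. indicator {c<..} s * normal_tail (t / s) \<partial>\<mu>)"

lemma integrable_mix_tail: "integrable \<mu> (\<lambda>s. indicator {c<..} s * normal_tail (t / s))"
  by (rule integrable_const_bound[where B=1])
     (auto split: split_indicator simp: normal_tail_nonneg normal_tail_le_1)

lemma mix_tail_nonneg: "0 \<le> mix_tail c t"
  unfolding mix_tail_def by (intro integral_nonneg_AE) (auto simp: normal_tail_nonneg)

lemma mix_tail_antimono:
  assumes "0 \<le> c" "t \<le> u"
  shows "mix_tail c u \<le> mix_tail c t"
  unfolding mix_tail_def
  using assms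
  by (intro integral_mono integrable_mix_tail)
     (auto split: split_indicator intro!: normal_tail_antimono divide_right_mono)

lemma mix_tail_cutoff_antimono: "c \<le> d \<Longrightarrow> mix_tail d t \<le> mix_tail c t"
  unfolding mix_tail_def
  by (intro integral_mono integrable_mix_tail) (auto split: split_indicator simp: normal_tail_nonneg)

lemma mix_tail_upper:
  assumes "0 \<le> t"
  shows "mix_tail 0 t \<le> normal_tail t"
proof -
  have "mix_tail 0 t \<le> (\<integral>s. normal_tail t \<partial>\<mu>)"
    unfolding mix_tail_def
  proof (rule integral_mono_AE[OF integrable_mix_tail])
    show "AE s in \<mu>. indicator {0<..} s * normal_tail (t / s) \<le> normal_tail t"
      using scale_le_1
    proof eventually_elim
      case (elim s)
      then show ?case using assms
        by (auto split: split_indicator simp: normal_tail_nonneg le_divide_eq mult_left_le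
            intro!: normal_tail_antimono)
    qed
  qed simp
  then show ?thesis by (simp add: prob_space[unfolded space_eq_univ])
qed

lemma mix_tail_lower:
  assumes "0 \<le> c" "c \<le> d" "0 < d" "0 \<le> t"
  shows "measure \<mu> {d<..} * normal_tail (t / d) \<le> mix_tail c t"
proof -
  have "measure \<mu> {d<..} * normal_tail (t / d) = (\<integral>s. indicator {d<..} s * normal_tail (t / d) \<partial>\<mu>)"
    by simp
  also have "\<dots> \<le> mix_tail c t"
    unfolding mix_tail_def
    using assms
    by (intro integral_mono integrable_mix_tail)
       (auto split: split_indicator simp: normal_tail_nonneg less_top[symmetric] emeasure_eq_measure
         intro!: normal_tail_antimono divide_left_mono)
  finally show ?thesis .
qed

lemma mix_tail_pos:
  assumes "0 \<le> c" "c < 1" "0 < t"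
  shows "0 < mix_tail c t"
proof -
  \<comment> \<open>The midpoint of c and 1 is used rather than c, because the threshold is a
    divisor and c may be 0.\<close>
  have "0 < measure \<mu> {(c + 1) / 2<..} * normal_tail (t / ((c + 1) / 2))"
    using assms by (intro mult_pos_pos mass_near_1 normal_tail_pos) auto
  also have "\<dots> \<le> mix_tail c t" using assms by (intro mix_tail_lower) auto
  finally show ?thesis .
qed

text \<open>A scale in (0, c] satisfies t / s >= t / c, so all such scales together contribute at
  most one tail at t / c.\<close>

lemma mix_tail_split:
  assumes "0 < c" "0 \<le> t"
  shows "mix_tail 0 t \<le> mix_tail c t + normal_tail (t / c)"
proof -
  have "mix_tail 0 t \<le> (\<integral>s. indicator {c<..} s * normal_tail (t / s) + normal_tail (t / c) \<partial>\<mu>)"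
    unfolding mix_tail_def using assms
    by (intro integral_mono integrable_mix_tail Bochner_Integration.integrable_add)
       (auto split: split_indicator simp: normal_tail_nonneg intro!: normal_tail_antimono divide_left_mono)
  also have "\<dots> = mix_tail c t + normal_tail (t / c)"
    by (subst Bochner_Integration.integral_add[OF integrable_mix_tail])
       (simp_all add: mix_tail_def prob_space[unfolded space_eq_univ])
  finally show ?thesis .
qed

text \<open>With c < d < 1, the discarded scales contribute at most Q(t / c), while the kept ones
  contribute at least p Q(t / d) with p > 0. The quotient Q(t / c) / Q(t / d) decays like a Gaussian
  because c < d.\<close>

lemma mix_tail_concentration:
  assumes c: "0 < c" "c < 1" and "1 < r"
  shows "eventually (\<lambda>t. mix_tail 0 t \<le> r * mix_tail c t) at_top"
proof -
  define d where "d = (c + 1) / 2"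
  define p where "p = measure \<mu> {d<..}"
  have d: "c < d" "d < 1" "0 < d" using c by (auto simp: d_def)
  have p: "0 < p" unfolding p_def using d by (intro mass_near_1)
  define K where "K = 1 / c\<^sup>2 - 1 / d\<^sup>2"
  have K: "K > 0" unfolding K_def using c d
    by (simp add: divide_strict_left_mono power_strict_mono)
  have "((\<lambda>t::real. exp (- (K / 2) * t\<^sup>2) * (c / d) * (1 + d\<^sup>2 * (1 / t\<^sup>2))) \<longlongrightarrow> 0) at_top"
    using K by real_asymp
  \<comment> \<open>The threshold (r - 1) p makes the discarded part at most (r - 1) times the kept
    part, so \<open>mix_tail_split\<close> yields the factor r.\<close>
  then have "eventually (\<lambda>t. exp (- (K / 2) * t\<^sup>2) * (c / d) * (1 + d\<^sup>2 * (1 / t\<^sup>2)) < (r - 1) * p) at_top"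
    using p \<open>1 < r\<close> by (intro order_tendstoD(2)[where y=0]) auto
  with eventually_gt_at_top[of 0] show ?thesis
  proof eventually_elim
    case (elim t)
    have eq: "((t / d)\<^sup>2 - (t / c)\<^sup>2) / 2 = - (K / 2) * t\<^sup>2"
      by (simp add: K_def power_divide algebra_simps diff_divide_distrib)
    have "normal_tail (t / c) \<le> exp (((t / d)\<^sup>2 - (t / c)\<^sup>2) / 2) * ((t / d) / (t / c)) * (1 + 1 / (t / d)\<^sup>2) * normal_tail (t / d)"
      using c d elim(1) by (intro normal_tail_comparison) auto
    also have "\<dots> = exp (- (K / 2) * t\<^sup>2) * (c / d) * (1 + d\<^sup>2 * (1 / t\<^sup>2)) * normal_tail (t / d)"
      unfolding eq using elim(1) by (simp add: power_divide)
    also have "\<dots> \<le> (r - 1) * p * normal_tail (t / d)"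
      by (intro mult_right_mono less_imp_le[OF elim(2)] normal_tail_nonneg)
    also have "\<dots> \<le> (r - 1) * mix_tail c t"
      using mix_tail_lower[of c d t] c d elim(1) \<open>1 < r\<close> by (simp add: p_def mult.assoc)
    finally show ?case using mix_tail_split[of c t] c elim(1) by (simp add: algebra_simps)
  qed
qed

text \<open>The normal tails are compared under the integral, scale by scale. The exponent at scale
  s exceeds (t^2 - u^2) / 2 by (t^2 - u^2) / 2 * (1/s^2 - 1), and \<open>\<eta>\<close> bounds this
  excess uniformly over c < s <= 1.\<close>

lemma mix_tail_comparison:
  assumes c: "0 < c" and tu: "0 < t" "0 < u" and \<eta>: "\<bar>t\<^sup>2 - u\<^sup>2\<bar> / 2 * (1 / c\<^sup>2 - 1) \<le> \<eta>"
  shows "mix_tail c u \<le> exp ((t\<^sup>2 - u\<^sup>2) / 2 + \<eta>) * (t / u) * (1 + 1 / t\<^sup>2) * mix_tail c t"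
    (is "_ \<le> ?C * _")
proof -
  have "mix_tail c u \<le> (\<integral>s. ?C * (indicator {c<..} s * normal_tail (t / s)) \<partial>\<mu>)"
    unfolding mix_tail_def
  proof (rule integral_mono_AE)
    show "AE s in \<mu>. indicator {c<..} s * normal_tail (u / s)
        \<le> ?C * (indicator {c<..} s * normal_tail (t / s))"
      using scale_le_1
    proof eventually_elim
      case (elim s)
      show ?case
      proof (cases "c < s")
        case True
        then have s: "0 < s" "c < s" "s \<le> 1" using c elim by auto
        have "1 / s\<^sup>2 \<le> 1 / c\<^sup>2" "1 \<le> 1 / s\<^sup>2"
          using s c by (auto intro!: divide_left_mono power_mono simp: power_le_one)
        then have "(t\<^sup>2 - u\<^sup>2) / 2 * (1 / s\<^sup>2 - 1) \<le> \<bar>t\<^sup>2 - u\<^sup>2\<bar> / 2 * (1 / c\<^sup>2 - 1)"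
          by (intro mult_mono divide_right_mono abs_ge_self) auto
        with \<eta> have e: "((t / s)\<^sup>2 - (u / s)\<^sup>2) / 2 \<le> (t\<^sup>2 - u\<^sup>2) / 2 + \<eta>"
          by (simp add: power_divide algebra_simps diff_divide_distrib)
        have "normal_tail (u / s) \<le> exp (((t / s)\<^sup>2 - (u / s)\<^sup>2) / 2) * ((t / s) / (u / s)) * (1 + 1 / (t / s)\<^sup>2) * normal_tail (t / s)"
          using s tu by (intro normal_tail_comparison) auto
        also have "\<dots> \<le> ?C * normal_tail (t / s)"
        proof (intro mult_right_mono mult_mono normal_tail_nonneg)
          have "s\<^sup>2 / t\<^sup>2 \<le> 1 / t\<^sup>2" using s by (intro divide_right_mono power_le_one) auto
          then show "1 + 1 / (t / s)\<^sup>2 \<le> 1 + 1 / t\<^sup>2" by (simp add: power_divide)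
        qed (use s tu e in simp_all)
        finally show ?thesis using True by simp
      qed simp
    qed
  qed (intro integrable_mult_right integrable_mix_tail)+
  also have "\<dots> = ?C * mix_tail c t"
    by (simp add: mix_tail_def)
  finally show ?thesis .
qed

text \<open>Each of the three \<open>\<eta>\<close> pays for one approximation: dropping the scales
  up to c, replacing 1/s^2 by 1 in the exponent, and replacing the remaining prefactor by its
  limit.\<close>

lemma mix_tail_shift_bounds:
  fixes x \<eta> :: real
  assumes "0 < \<eta>"
  shows "eventually (\<lambda>t. mix_tail 0 (t + x / t) \<le> exp (- x + 3 * \<eta>) * mix_tail 0 t \<and>
                          mix_tail 0 t \<le> exp (x + 3 * \<eta>) * mix_tail 0 (t + x / t)) at_top"
proof -
  \<comment> \<open>Chosen so that 1/c^2 = q and (|x| + 1) (1/c^2 - 1) = \<open>\<eta>\<close>. The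
    added 1 leaves room because |t^2 - u^2| / 2 only tends to |x|, and it covers x = 0.\<close>
  define q where "q = 1 + \<eta> / (\<bar>x\<bar> + 1)"
  define c where "c = 1 / sqrt q"
  have q: "1 < q" unfolding q_def using assms by simp
  then have c: "0 < c" "c < 1" "1 / c\<^sup>2 = q" by (auto simp: c_def power_divide)
  define u where "u = (\<lambda>t::real. t + x / t)"
  have u: "filterlim u at_top at_top"
    unfolding u_def by real_asymp
  have "((\<lambda>t. (t\<^sup>2 - (u t)\<^sup>2) / 2) \<longlongrightarrow> - x) at_top"
    unfolding u_def by real_asymp
  then have "((\<lambda>t. \<bar>t\<^sup>2 - (u t)\<^sup>2\<bar> / 2) \<longlongrightarrow> \<bar>x\<bar>) at_top"
    using tendsto_rabs by fastforce
  then have ev1: "eventually (\<lambda>t. \<bar>t\<^sup>2 - (u t)\<^sup>2\<bar> / 2 < \<bar>x\<bar> + 1) at_top"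
    by (rule order_tendstoD(2)) simp
  have "((\<lambda>t. exp ((t\<^sup>2 - (u t)\<^sup>2) / 2) * (t / u t) * (1 + 1 / t\<^sup>2)) \<longlongrightarrow> exp (- x)) at_top"
    unfolding u_def by real_asymp
  then have ev2: "eventually (\<lambda>t. exp ((t\<^sup>2 - (u t)\<^sup>2) / 2) * (t / u t) * (1 + 1 / t\<^sup>2) < exp (- x + \<eta>)) at_top"
    using assms by (intro order_tendstoD(2)) auto
  have "((\<lambda>t. exp (((u t)\<^sup>2 - t\<^sup>2) / 2) * (u t / t) * (1 + 1 / (u t)\<^sup>2)) \<longlongrightarrow> exp x) at_top"
    unfolding u_def by real_asymp
  then have ev3: "eventually (\<lambda>t. exp (((u t)\<^sup>2 - t\<^sup>2) / 2) * (u t / t) * (1 + 1 / (u t)\<^sup>2) < exp (x + \<eta>)) at_top"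
    using assms by (intro order_tendstoD(2)) auto
  have ev4: "eventually (\<lambda>t. mix_tail 0 t \<le> exp \<eta> * mix_tail c t) at_top"
    using c assms by (intro mix_tail_concentration) auto
  have ev5: "eventually (\<lambda>t. mix_tail 0 (u t) \<le> exp \<eta> * mix_tail c (u t)) at_top"
    using u ev4 by (rule eventually_compose_filterlim[rotated])
  have ev6: "eventually (\<lambda>t. 0 < u t) at_top"
    using u by (simp add: filterlim_at_top_dense)
  show ?thesis
    using ev1 ev2 ev3 ev4 ev5 ev6 eventually_gt_at_top[of 0]
  proof eventually_elim
    case (elim t)
    have "\<bar>t\<^sup>2 - (u t)\<^sup>2\<bar> / 2 * (1 / c\<^sup>2 - 1) \<le> (\<bar>x\<bar> + 1) * (1 / c\<^sup>2 - 1)"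
      using elim(1) q unfolding c(3) by (intro mult_right_mono) auto
    also have "\<dots> = \<eta>" unfolding c(3) q_def by simp
    finally have \<eta>: "\<bar>t\<^sup>2 - (u t)\<^sup>2\<bar> / 2 * (1 / c\<^sup>2 - 1) \<le> \<eta>" .
    \<comment> \<open>Both inequalities are instances: (v, w, y) is (t, u t, - x) for the first and
      (u t, t, x) for the second.\<close>
    have bound: "mix_tail 0 w \<le> exp (y + 3 * \<eta>) * mix_tail 0 v"
      if vw: "0 < v" "0 < w" and *: "\<bar>v\<^sup>2 - w\<^sup>2\<bar> / 2 * (1 / c\<^sup>2 - 1) \<le> \<eta>"
        "exp ((v\<^sup>2 - w\<^sup>2) / 2) * (v / w) * (1 + 1 / v\<^sup>2) < exp (y + \<eta>)"
        "mix_tail 0 w \<le> exp \<eta> * mix_tail c w"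
      for v w y :: real
    proof -
      have "mix_tail 0 w \<le> exp \<eta> * mix_tail c w" by fact
      also have "\<dots> \<le> exp \<eta> * (exp ((v\<^sup>2 - w\<^sup>2) / 2 + \<eta>) * (v / w) * (1 + 1 / v\<^sup>2) * mix_tail c v)"
        using c vw * by (intro mult_left_mono mix_tail_comparison) auto
      also have "\<dots> = exp \<eta> * exp \<eta> * (exp ((v\<^sup>2 - w\<^sup>2) / 2) * (v / w) * (1 + 1 / v\<^sup>2)) * mix_tail c v"
        by (simp only: exp_add ac_simps)
      also have "\<dots> \<le> exp \<eta> * exp \<eta> * exp (y + \<eta>) * mix_tail 0 v"
        using c vw less_imp_le[OF *(2)]
        by (intro mult_mono mix_tail_cutoff_antimono mix_tail_nonneg order_refl) auto
      also have "exp \<eta> * exp \<eta> * exp (y + \<eta>) = exp (y + 3 * \<eta>)"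
        by (simp add: mult_exp_exp)
      finally show ?thesis .
    qed
    have "mix_tail 0 (u t) \<le> exp (- x + 3 * \<eta>) * mix_tail 0 t"
      using elim \<eta> by (intro bound) auto
    moreover have "mix_tail 0 t \<le> exp (x + 3 * \<eta>) * mix_tail 0 (u t)"
      using elim \<eta> by (intro bound) (auto simp: abs_minus_commute)
    ultimately show ?case by (simp add: u_def)
  qed
qed

text \<open>Taking logarithms turns the two multiplicative bounds into one bound by 3
  \<open>\<eta>\<close> on the distance of the log-ratio from - x.\<close>

lemma mix_tail_shift:
  "((\<lambda>t. mix_tail 0 (t + x / t) / mix_tail 0 t) \<longlongrightarrow> exp (- x)) at_top"
proof -
  have u: "filterlim (\<lambda>t. t + x / t) at_top at_top"
    by real_asymp
  then have u_pos: "eventually (\<lambda>t. 0 < t + x / t) at_top"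
    by (simp add: filterlim_at_top_dense)
  have "((\<lambda>t. ln (mix_tail 0 (t + x / t) / mix_tail 0 t)) \<longlongrightarrow> - x) at_top"
  proof (rule tendstoI)
    fix e :: real assume "0 < e"
    then have "0 < e / 4" by simp
    from mix_tail_shift_bounds[OF this, of x] u_pos eventually_gt_at_top[of 0]
    show "eventually (\<lambda>t. dist (ln (mix_tail 0 (t + x / t) / mix_tail 0 t)) (- x) < e) at_top"
    proof eventually_elim
      case (elim t)
      have pos: "0 < mix_tail 0 t" "0 < mix_tail 0 (t + x / t)"
        using elim by (auto intro!: mix_tail_pos)
      have "ln (mix_tail 0 (t + x / t)) \<le> ln (exp (- x + 3 * (e / 4)) * mix_tail 0 t)"
           "ln (mix_tail 0 t) \<le> ln (exp (x + 3 * (e / 4)) * mix_tail 0 (t + x / t))"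
        using elim(1) pos by (auto simp: ln_le_cancel_iff)
      with pos \<open>0 < e\<close> show ?case by (simp add: ln_mult ln_div dist_real_def)
    qed
  qed
  then have "((\<lambda>t. exp (ln (mix_tail 0 (t + x / t) / mix_tail 0 t))) \<longlongrightarrow> exp (- x)) at_top"
    by (rule tendsto_exp)
  then show ?thesis
  proof (rule Lim_transform_eventually)
    show "eventually (\<lambda>t. exp (ln (mix_tail 0 (t + x / t) / mix_tail 0 t))
        = mix_tail 0 (t + x / t) / mix_tail 0 t) at_top"
      using u_pos eventually_gt_at_top[of 0]
      by eventually_elim (simp add: mix_tail_pos)
  qed
qed

section \<open>Logarithmic decay of the mixture tail\<close>

lemma ln_mix_tail_upper:
  assumes "1 \<le> t"
  shows "ln (mix_tail 0 t) / t\<^sup>2 \<le> - 1 / 2"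
proof -
  have "mix_tail 0 t \<le> std_normal_density t / t"
    using mix_tail_upper[of t] normal_tail_upper[of t] assms by simp
  also have "\<dots> \<le> std_normal_density t / 1"
    using assms by (intro divide_left_mono) (auto simp: normal_density_nonneg)
  also have "\<dots> \<le> exp (- t\<^sup>2 / 2)"
  proof -
    have "1 \<le> 2 * pi" using pi_ge_two by linarith
    then have "exp (- t\<^sup>2 / 2) / sqrt (2 * pi) \<le> exp (- t\<^sup>2 / 2) / 1"
      by (intro divide_left_mono) auto
    then show ?thesis by (simp add: std_normal_density_def)
  qed
  finally have "ln (mix_tail 0 t) \<le> ln (exp (- t\<^sup>2 / 2))"
    using assms mix_tail_pos[of 0 t] by (subst ln_le_cancel_iff) auto
  then show ?thesis using assms by (simp add: field_simps)
qed

text \<open>Only scales above c are kept, and the lower Mills bound is applied at t / c. Since t / c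
  >= 1, its factor 1 + 1 / (t / c)^2 is at most 2, which is the 2 in the constant.\<close>

lemma ln_mix_tail_lower:
  assumes c: "0 < c" "c < 1" and t: "1 \<le> t"
  shows "ln (measure \<mu> {c<..} * c / (2 * sqrt (2 * pi))) - ln t - t\<^sup>2 / (2 * c\<^sup>2) \<le> ln (mix_tail 0 t)"
proof -
  define p where "p = measure \<mu> {c<..}"
  define k where "k = 1 / sqrt (2 * pi)"
  have p: "0 < p" unfolding p_def using c by (intro mass_near_1)
  have k: "0 < k" unfolding k_def by simp
  have "c\<^sup>2 \<le> 1\<^sup>2" "1\<^sup>2 \<le> t\<^sup>2" using c t by (intro power_mono; simp)+
  then have "1 + 1 / (t / c)\<^sup>2 \<le> 2"
    using c t by (simp add: power_divide)
  then have "std_normal_density (t / c) / (t / c) \<le> 2 * normal_tail (t / c)"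
    using normal_tail_lower[of "t / c"] mult_right_mono[OF _ normal_tail_nonneg[of "t / c"]] c t
    by (meson divide_pos_pos less_le_trans order_trans zero_less_one)
  then have "p * (k * exp (- (t / c)\<^sup>2 / 2) / (t / c) / 2) \<le> p * normal_tail (t / c)"
    using p by (intro mult_left_mono) (auto simp: std_normal_density_def k_def)
  also have "\<dots> \<le> mix_tail 0 t" unfolding p_def using c t by (intro mix_tail_lower) auto
  finally have "p * c * k / 2 / t * exp (- (t / c)\<^sup>2 / 2) \<le> mix_tail 0 t"
    by (simp add: ac_simps)
  then have "ln (p * c * k / 2 / t * exp (- (t / c)\<^sup>2 / 2)) \<le> ln (mix_tail 0 t)"
    using p k c t mix_tail_pos[of 0 t] by (subst ln_le_cancel_iff) auto
  moreover have "ln (p * c * k / 2 / t * exp (- (t / c)\<^sup>2 / 2)) = ln (p * c * k / 2) - ln t - t\<^sup>2 / (2 * c\<^sup>2)"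
    using p k c t by (subst ln_mult) (simp_all add: ln_div ln_mult power_divide)
  moreover have "p * c * k / 2 = measure \<mu> {c<..} * c / (2 * sqrt (2 * pi))"
    by (simp add: p_def k_def)
  ultimately show ?thesis by simp
qed

lemma ln_mix_tail:
  "((\<lambda>t. ln (mix_tail 0 t) / t\<^sup>2) \<longlongrightarrow> - 1 / 2) at_top"
proof (rule tendstoI)
  fix e :: real assume "0 < e"
  \<comment> \<open>With 1/c^2 = 1 + e the lower bound divided by t^2 tends to - 1/2 - e/2, strictly
    above - 1/2 - e. The upper bound - 1/2 already holds for every t >= 1.\<close>
  define c where "c = 1 / sqrt (1 + e)"
  have c: "0 < c" "c < 1" "1 / c\<^sup>2 = 1 + e"
    using \<open>0 < e\<close> by (auto simp: c_def power_divide)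
  define K where "K = ln (measure \<mu> {c<..} * c / (2 * sqrt (2 * pi)))"
  have "((\<lambda>t. (K - ln t - t\<^sup>2 * ((1 + e) / 2)) / t\<^sup>2) \<longlongrightarrow> - ((1 + e) / 2)) at_top"
    by real_asymp
  then have "eventually (\<lambda>t. - (1 / 2 + e) < (K - ln t - t\<^sup>2 * ((1 + e) / 2)) / t\<^sup>2) at_top"
    by (rule order_tendstoD(1)) (use \<open>0 < e\<close> in \<open>simp add: field_simps\<close>)
  with eventually_ge_at_top[of 1]
  show "eventually (\<lambda>t. dist (ln (mix_tail 0 t) / t\<^sup>2) (- 1 / 2) < e) at_top"
  proof eventually_elim
    case (elim t)
    have "t\<^sup>2 / (2 * c\<^sup>2) = t\<^sup>2 * (1 / c\<^sup>2 / 2)" by simp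
    also have "\<dots> = t\<^sup>2 * ((1 + e) / 2)" by (simp only: c(3))
    finally have "(K - ln t - t\<^sup>2 * ((1 + e) / 2)) / t\<^sup>2 \<le> ln (mix_tail 0 t) / t\<^sup>2"
      using ln_mix_tail_lower[OF c(1,2) elim(1)] unfolding K_def by (intro divide_right_mono) auto
    with elim(2) ln_mix_tail_upper[OF elim(1)] show ?case
      by (simp add: dist_real_def)
  qed
qed

end

subsection \<open>Uniform convergence to the Gumbel distribution\<close>

text \<open>For h < 1, the logarithm of 1 - h lies between - h / (1 - h) and - h. Multiplied by n,
  both bounds tend to - L, because convergence of n h(n) forces h(n) to 0.\<close>

lemma tendsto_power_exp:
  fixes h :: "nat \<Rightarrow> real"
  assumes nh: "(\<lambda>n. real n * h n) \<longlonglongrightarrow> L"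
  shows "(\<lambda>n. (1 - h n) ^ n) \<longlonglongrightarrow> exp (- L)"
proof -
  have "(\<lambda>n. real n * h n * (1 / real n)) \<longlonglongrightarrow> L * 0"
    by (intro tendsto_mult nh lim_1_over_n)
  then have "(\<lambda>n. real n * h n * (1 / real n)) \<longlonglongrightarrow> 0" by simp
  then have h0: "h \<longlonglongrightarrow> 0"
    by (rule Lim_transform_eventually) (use eventually_gt_at_top[of 0] in \<open>eventually_elim, simp\<close>)
  then have h1: "eventually (\<lambda>n. h n < 1) sequentially"
    by (rule order_tendstoD(2)) simp
  have "(\<lambda>n. real n * ln (1 - h n)) \<longlonglongrightarrow> - L"
  proof (rule tendsto_sandwich)
    have "(\<lambda>n. - (real n * h n / (1 - h n))) \<longlonglongrightarrow> - (L / (1 - 0))"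
      by (intro tendsto_intros nh h0) simp
    then show "(\<lambda>n. - (real n * h n / (1 - h n))) \<longlonglongrightarrow> - L" by simp
    show "(\<lambda>n. - (real n * h n)) \<longlonglongrightarrow> - L"
      by (intro tendsto_minus nh)
    show "eventually (\<lambda>n. real n * ln (1 - h n) \<le> - (real n * h n)) sequentially"
      using h1
    proof eventually_elim
      case (elim n)
      then have "ln (1 - h n) \<le> - h n" using ln_le_minus_one[of "1 - h n"] by simp
      then show ?case using mult_left_mono[of "ln (1 - h n)" "- h n" "real n"] by simp
    qed
    show "eventually (\<lambda>n. - (real n * h n / (1 - h n)) \<le> real n * ln (1 - h n)) sequentially"
      using h1
    proof eventually_elim
      case (elim n)
      have "- ln (1 - h n) \<le> 1 / (1 - h n) - 1"
        using ln_le_minus_one[of "1 / (1 - h n)"] elim by (simp add: ln_div)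
      also have "\<dots> = h n / (1 - h n)" using elim by (simp add: field_simps)
      finally show ?case
        using mult_left_mono[of "- ln (1 - h n)" "h n / (1 - h n)" "real n"] by simp
    qed
  qed
  then have "(\<lambda>n. exp (real n * ln (1 - h n))) \<longlonglongrightarrow> exp (- L)"
    by (rule tendsto_exp)
  then show ?thesis
    by (rule Lim_transform_eventually) (use h1 in \<open>eventually_elim, simp add: exp_of_nat_mult\<close>)
qed

text \<open>Polya's argument: continuity provides points where L takes the values j / k, and
  closeness at these finitely many points spreads to all x by monotonicity. \<open>mono_F\<close> is
  asked only eventually, since the norming factor 1 / b(n) is known to be positive only for large
  n.\<close>

lemma polya_uniform_convergence:
  fixes F :: "nat \<Rightarrow> real \<Rightarrow> real" and L :: "real \<Rightarrow> real"
  assumes mono_F: "eventually (\<lambda>n. mono (F n)) sequentially"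
    and bounds: "\<And>n x. 0 \<le> F n x" "\<And>n x. F n x \<le> 1"
    and mono_L: "mono L" and cont: "continuous_on UNIV L"
    and bot: "(L \<longlongrightarrow> 0) at_bot" and top: "(L \<longlongrightarrow> 1) at_top"
    and lim: "\<And>x. (\<lambda>n. F n x) \<longlonglongrightarrow> L x"
  shows "(\<lambda>n. SUP x. \<bar>F n x - L x\<bar>) \<longlonglongrightarrow> 0"
proof (rule tendstoI)
  fix e :: real assume "0 < e"
  have L_ge: "0 \<le> L x" for x using lim[of x] bounds by (intro LIMSEQ_le_const) auto
  have L_le: "L x \<le> 1" for x using lim[of x] bounds by (intro LIMSEQ_le_const2) auto
  \<comment> \<open>The final error is at most 2 / k + e / 4, hence below 3 e / 4.\<close>
  obtain k :: nat where k: "4 / e < real k" using reals_Archimedean2 by blast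
  have "0 < real k" using k \<open>0 < e\<close> by (meson divide_pos_pos less_trans zero_less_numeral)
  with k \<open>0 < e\<close> have k: "0 < real k" "1 / real k < e / 4" by (auto simp: field_simps)
  have "\<exists>x. L x = y" if y: "0 < y" "y < 1" for y
  proof -
    obtain u where u: "L u < y"
      using eventually_happens'[OF _ order_tendstoD(2)[OF bot y(1)]] by auto
    obtain v where v: "y < L v"
      using eventually_happens'[OF _ order_tendstoD(1)[OF top y(2)]] by auto
    have "u \<le> v" using u v monoD[OF mono_L, of v u] by linarith
    then have "\<exists>x\<ge>u. x \<le> v \<and> L x = y"
      using u v by (intro IVT' continuous_on_subset[OF cont]) auto
    then show ?thesis by blast
  qed
  then have "\<forall>j\<in>{1..<k}. \<exists>x. L x = real j / real k"
    using k by auto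
  then obtain X where X: "\<And>j. j \<in> {1..<k} \<Longrightarrow> L (X j) = real j / real k"
    by metis
  have "eventually (\<lambda>n. \<forall>j\<in>{1..<k}. dist (F n (X j)) (L (X j)) < e / 4) sequentially"
    using \<open>0 < e\<close> by (intro eventually_ball_finite ballI tendstoD[OF lim]) auto
  with mono_F show "eventually (\<lambda>n. dist (SUP x. \<bar>F n x - L x\<bar>) 0 < e) sequentially"
  proof eventually_elim
    case (elim n)
    have close: "\<bar>F n (X j) - real j / real k\<bar> < e / 4" if "j \<in> {1..<k}" for j
      using bspec[OF elim(2) that] unfolding X[OF that] dist_real_def .
    have main: "\<bar>F n x - L x\<bar> \<le> 3 * e / 4" for x
    proof -
      define j where "j = nat \<lfloor>real k * L x\<rfloor>"
      have "real j \<le> real k * L x" "real k * L x < real j + 1"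
        using L_ge[of x] k(1) by (auto simp: j_def)
      then have j: "real j / real k \<le> L x" "L x < (real j + 1) / real k"
        using k(1) by (auto simp: field_simps)
      have "real j / real k \<le> 1" using j(1) L_le[of x] by linarith
      then have jk: "j \<le> k" using k(1) by simp
      have upper: "F n x \<le> L x + 1 / real k + e / 4"
      proof (cases "j + 1 < k")
        case True
        then have *: "j + 1 \<in> {1..<k}" by auto
        have "x \<le> X (j + 1)"
        proof -
          have "L x < L (X (j + 1))" using X[OF *] j(2) by (simp add: add.commute)
          then show ?thesis
            using monoD[OF mono_L, of "X (j + 1)" x] by (cases "X (j + 1) \<le> x") auto
        qed
        then have "F n x \<le> F n (X (j + 1))" by (rule monoD[OF elim(1)])
        also have "\<dots> \<le> real (j + 1) / real k + e / 4" using close[OF *] by linarith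
        also have "real (j + 1) / real k = real j / real k + 1 / real k"
          by (simp add: add_divide_distrib)
        finally show ?thesis using j(1) by linarith
      next
        case False
        \<comment> \<open>The index j + 1 is outside the grid, but L x + 1 / k >= 1 already
          dominates F n x.\<close>
        then have "1 \<le> (real j + 1) / real k" using k(1) by (simp add: le_divide_eq)
        also have "\<dots> = real j / real k + 1 / real k" by (simp add: add_divide_distrib)
        finally show ?thesis using bounds(2)[of n x] j(1) \<open>0 < e\<close> by linarith
      qed
      have lower: "L x - 2 / real k - e / 4 \<le> F n x"
      proof (cases "2 \<le> j")
        case True
        \<comment> \<open>The index j would not do: L x = j / k is possible with x to the left of X
          j. A strict inequality between values of L is needed to order the points, and this costs
          the second 1 / k.\<close>
        then have *: "j - 1 \<in> {1..<k}" using jk by auto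
        have eq: "real (j - 1) / real k = (real j + 1) / real k - 2 / real k"
          using True by (simp add: diff_divide_distrib[symmetric] of_nat_diff)
        have "real (j - 1) / real k < real j / real k"
          using True k(1) by (intro divide_strict_right_mono) auto
        then have "X (j - 1) \<le> x"
          using X[OF *] j(1) monoD[OF mono_L, of x "X (j - 1)"] by force
        then have "F n (X (j - 1)) \<le> F n x" by (rule monoD[OF elim(1)])
        then show ?thesis using close[OF *] eq j(2) by linarith
      next
        case False
        then have "(real j + 1) / real k \<le> 2 / real k" using k(1) by (intro divide_right_mono) auto
        then show ?thesis using bounds(1)[of n x] j(2) \<open>0 < e\<close> by linarith
      qed
      have "2 / real k = 1 / real k + 1 / real k" by simp
      then show ?thesis using upper lower k(2) by linarith
    qed
    have "(SUP x. \<bar>F n x - L x\<bar>) \<le> 3 * e / 4"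
      by (intro cSUP_least main) auto
    moreover have "0 \<le> (SUP x. \<bar>F n x - L x\<bar>)"
      by (rule cSUP_upper2[of "\<lambda>x. \<bar>F n x - L x\<bar>" UNIV 0])
         (auto intro!: bdd_aboveI2[of _ _ "3 * e / 4"] main)
    ultimately show ?case using \<open>0 < e\<close> by (simp add: dist_real_def)
  qed
qed

lemma mono_Gumbel: "mono Gumbel"
  by (auto simp: Gumbel_def intro!: monoI)

lemma continuous_on_Gumbel: "continuous_on A Gumbel"
  unfolding Gumbel_def by (intro continuous_intros)

lemma Gumbel_at_bot: "(Gumbel \<longlongrightarrow> 0) at_bot"
  unfolding Gumbel_def by real_asymp

lemma Gumbel_at_top: "(Gumbel \<longlongrightarrow> 1) at_top"
  unfolding Gumbel_def by real_asymp

subsection \<open>Norming constants from the tail\<close>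

text \<open>The extreme value argument uses only these tail properties. \<open>H\<close> is tied to
  \<open>G\<close> at positive arguments only, where the mixture formula represents the tail.
  \<open>right_continuous_mono\<close> supplies the Galois connection of the generalised
  inverse.\<close>

locale gumbel_tail = right_continuous_mono G 0 1 for G :: "real \<Rightarrow> real" +
  fixes H :: "real \<Rightarrow> real"
  assumes tail: "\<And>t. 0 < t \<Longrightarrow> G t = 1 - H t"
    and tail_pos: "\<And>t. 0 < t \<Longrightarrow> 0 < H t"
    and tail_shift: "\<And>x. ((\<lambda>t. H (t + x / t) / H t) \<longlongrightarrow> exp (- x)) at_top"
    and ln_tail: "((\<lambda>t. ln (H t) / t\<^sup>2) \<longlongrightarrow> - 1 / 2) at_top"
begin

abbreviation quantile :: "nat \<Rightarrow> real" where
  "quantile n \<equiv> gen_inv G (1 - 1 / real n)"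

text \<open>The bound on n puts the level 1 - 1/n strictly between 0 and 1, as the Galois connection
  requires; n = 1 would give level 0.\<close>

lemma quantile_le_iff: "2 \<le> n \<Longrightarrow> quantile n \<le> x \<longleftrightarrow> 1 - 1 / real n \<le> G x"
  unfolding gen_inv_def by (rule pseudoinverse[symmetric]) (auto simp: field_simps)

lemma filterlim_quantile: "filterlim quantile at_top sequentially"
proof (rule filterlim_at_top_gt[where c=0, THEN iffD2], intro allI impI)
  fix Z :: real assume Z: "0 < Z"
  have "eventually (\<lambda>n. 1 / real n < H Z) sequentially"
    using lim_1_over_n tail_pos[OF Z] by (rule order_tendstoD(2))
  with eventually_ge_at_top[of 2] show "eventually (\<lambda>n. Z \<le> quantile n) sequentially"
  proof eventually_elim
    case (elim n)
    then have "\<not> quantile n \<le> Z" unfolding quantile_le_iff[OF elim(1)] tail[OF Z] by simp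
    then show ?case by simp
  qed
qed

lemma eventually_quantile_pos: "eventually (\<lambda>n. 0 < quantile n) sequentially"
  using filterlim_quantile by (simp add: filterlim_at_top_dense)

lemma quantile_shift:
  "(\<lambda>n. H (quantile n + x / quantile n) / H (quantile n)) \<longlonglongrightarrow> exp (- x)"
  using tail_shift filterlim_quantile by (rule filterlim_compose)

text \<open>The Galois connection gives n H(b) <= 1 at the quantile b. As G might jump at b, the
  lower bound comes from the point t = b - x / b to its left: there n H(t) > 1, and H(b) / H(t)
  tends to exp(- x), which is close to 1 for small x > 0.\<close>

lemma tail_quantile: "(\<lambda>n. real n * H (quantile n)) \<longlonglongrightarrow> 1"
proof (rule order_tendstoI)
  fix y :: real assume "1 < y"
  show "eventually (\<lambda>n. real n * H (quantile n) < y) sequentially"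
    using eventually_ge_at_top[of 2] eventually_quantile_pos
  proof eventually_elim
    case (elim n)
    have "1 - 1 / real n \<le> G (quantile n)" using quantile_le_iff[OF elim(1)] by blast
    then have "real n * H (quantile n) \<le> 1"
      using elim by (simp add: tail field_simps)
    with \<open>1 < y\<close> show ?case by simp
  qed
next
  fix y :: real assume "y < 1"
  have "((\<lambda>x::real. exp (- x)) \<longlongrightarrow> 1) (at_right 0)"
    by (rule tendsto_eq_intros refl | simp)+
  then have "eventually (\<lambda>x::real. y < exp (- x) \<and> 0 < x) (at_right 0)"
    using \<open>y < 1\<close> by (intro eventually_conj eventually_at_right_less) (rule order_tendstoD(1))
  then obtain x where x: "y < exp (- x)" "0 < x"
    using eventually_happens' trivial_limit_at_right_real by blast
  have "(\<lambda>n. H (quantile n) / H (quantile n + (- x) / quantile n)) \<longlonglongrightarrow> exp (- x)"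
    using tendsto_inverse[OF quantile_shift[of "- x"]] by (simp add: exp_minus)
  then have "eventually (\<lambda>n. y < H (quantile n) / H (quantile n + (- x) / quantile n)) sequentially"
    using x(1) by (rule order_tendstoD(1))
  moreover have "filterlim (\<lambda>n. quantile n + (- x) / quantile n) at_top sequentially"
    by (rule filterlim_compose[OF _ filterlim_quantile]) real_asymp
  then have "eventually (\<lambda>n. 0 < quantile n + (- x) / quantile n) sequentially"
    unfolding filterlim_at_top_dense by blast
  ultimately show "eventually (\<lambda>n. y < real n * H (quantile n)) sequentially"
    using eventually_ge_at_top[of 2] eventually_quantile_pos
  proof eventually_elim
    case (elim n)
    let ?t = "quantile n + (- x) / quantile n"
    have "\<not> quantile n \<le> ?t" using x(2) elim(4) by (simp add: field_simps)
    then have "1 / real n < H ?t"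
      using quantile_le_iff[OF elim(3), of ?t] tail[OF elim(2)] by simp
    then have "1 / H ?t < real n" using elim(3) tail_pos[OF elim(2)] by (simp add: field_simps)
    then have "H (quantile n) * (1 / H ?t) \<le> H (quantile n) * real n"
      using tail_pos[OF elim(4)] by (intro mult_left_mono) auto
    with elim(1) show ?case by (simp add: mult.commute)
  qed
qed

lemma tail_quantile_shift:
  "(\<lambda>n. real n * H (quantile n + x / quantile n)) \<longlonglongrightarrow> exp (- x)"
proof -
  have "(\<lambda>n. real n * H (quantile n) * (H (quantile n + x / quantile n) / H (quantile n))) \<longlonglongrightarrow> 1 * exp (- x)"
    by (intro tendsto_mult tail_quantile quantile_shift)
  then show ?thesis unfolding mult_1
  proof (rule Lim_transform_eventually)
    show "eventually (\<lambda>n. real n * H (quantile n) * (H (quantile n + x / quantile n) / H (quantile n))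
        = real n * H (quantile n + x / quantile n)) sequentially"
      using eventually_quantile_pos by eventually_elim (use tail_pos in force)
  qed
qed

lemma power_at_quantile_shift:
  "(\<lambda>n. G (quantile n + x / quantile n) ^ n) \<longlonglongrightarrow> Gumbel x"
proof -
  have "filterlim (\<lambda>n. quantile n + x / quantile n) at_top sequentially"
    by (rule filterlim_compose[OF _ filterlim_quantile]) real_asymp
  then have "eventually (\<lambda>n. 0 < quantile n + x / quantile n) sequentially"
    by (simp add: filterlim_at_top_dense)
  then have "eventually (\<lambda>n. (1 - H (quantile n + x / quantile n)) ^ n = G (quantile n + x / quantile n) ^ n) sequentially"
    by eventually_elim (simp add: tail)
  with tendsto_power_exp[OF tail_quantile_shift[of x]] show ?thesis
    unfolding Gumbel_def by (rule Lim_transform_eventually)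
qed

text \<open>Write ln n = ln (n H(b)) - ln H(b) and divide by b^2: the first term vanishes and the
  second tends to 1/2. So 2 ln n / b^2 tends to 1, and its square root is the stated
  quotient.\<close>

lemma quantile_asymp:
  "(\<lambda>n. (1 / quantile n) / (2 * ln (real n)) powr (-1/2)) \<longlonglongrightarrow> 1"
proof -
  have "filterlim (\<lambda>n. (quantile n)\<^sup>2) at_top sequentially"
    by (intro filterlim_pow_at_top filterlim_quantile) simp
  then have "(\<lambda>n. ln (real n * H (quantile n)) / (quantile n)\<^sup>2) \<longlonglongrightarrow> 0"
    by (intro tendsto_divide_0[OF tendsto_ln[OF tail_quantile]] filterlim_at_top_imp_at_infinity) auto
  moreover have "(\<lambda>n. ln (H (quantile n)) / (quantile n)\<^sup>2) \<longlonglongrightarrow> - 1 / 2"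
    using ln_tail filterlim_quantile by (rule filterlim_compose)
  ultimately have "(\<lambda>n. sqrt (2 * (ln (real n * H (quantile n)) / (quantile n)\<^sup>2 - ln (H (quantile n)) / (quantile n)\<^sup>2)))
      \<longlonglongrightarrow> sqrt (2 * (0 - - 1 / 2))"
    by (intro tendsto_real_sqrt tendsto_mult tendsto_const tendsto_diff)
  then have "(\<lambda>n. sqrt (2 * (ln (real n * H (quantile n)) / (quantile n)\<^sup>2 - ln (H (quantile n)) / (quantile n)\<^sup>2)))
      \<longlonglongrightarrow> 1" by simp
  then show ?thesis
  proof (rule Lim_transform_eventually)
    show "eventually (\<lambda>n. sqrt (2 * (ln (real n * H (quantile n)) / (quantile n)\<^sup>2 - ln (H (quantile n)) / (quantile n)\<^sup>2))
       = (1 / quantile n) / (2 * ln (real n)) powr (-1/2)) sequentially"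
      using eventually_ge_at_top[of 2] eventually_quantile_pos
    proof eventually_elim
      case (elim n)
      have "ln (real n * H (quantile n)) / (quantile n)\<^sup>2 - ln (H (quantile n)) / (quantile n)\<^sup>2 = ln (real n) / (quantile n)\<^sup>2"
        using elim tail_pos[OF elim(2)] by (simp add: ln_mult add_divide_distrib)
      then have "sqrt (2 * (ln (real n * H (quantile n)) / (quantile n)\<^sup>2 - ln (H (quantile n)) / (quantile n)\<^sup>2))
          = sqrt (2 * ln (real n)) / quantile n"
        using elim by (simp add: real_sqrt_divide)
      also have "(2 * ln (real n)) powr (-1/2) = 1 / sqrt (2 * ln (real n))"
        using elim by (simp add: powr_minus_divide powr_half_sqrt)
      ultimately show ?case by simp
    qed
  qed
qed

end

subsection \<open>Products of a bounded scale and a normal variable\<close>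

lemma distr_indep_mult:
  assumes "prob_space M" and "prob_space.indep_var M borel S borel (X :: 'a \<Rightarrow> real)"
  shows "distr M borel (\<lambda>\<omega>. S \<omega> * X \<omega>)
       = distr (distr M borel S \<Otimes>\<^sub>M distr M borel X) borel (\<lambda>p. fst p * snd p)"
proof -
  interpret prob_space M by fact
  have rv [measurable]: "S \<in> borel_measurable M" "X \<in> borel_measurable M"
    and joint: "distr M borel S \<Otimes>\<^sub>M distr M borel X = distr M (borel \<Otimes>\<^sub>M borel) (\<lambda>\<omega>. (S \<omega>, X \<omega>))"
    using assms(2) unfolding indep_var_distribution_eq by auto
  show ?thesis
    unfolding joint by (subst distr_distr) (simp_all add: comp_def)
qed

lemma distr_std_normal:
  assumes "distributed M lborel X (\<lambda>x. ennreal (std_normal_density x))"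
  shows "distr M borel X = std_normal"
proof -
  have "distr M borel X = distr M lborel X" by (rule distr_cong) auto
  also have "\<dots> = std_normal" using assms by (rule distributed_distr_eq_density)
  finally show ?thesis .
qed

lemma measure_scaled_std_normal:
  assumes "0 \<le> s" "0 < t"
  shows "measure std_normal {x. t < s * x} = indicator {0<..} s * normal_tail (t / s)"
\<comment> \<open>At s = 0 the event is empty, and the indicator removes the value of the tail at t
  / 0.\<close>
proof (cases "s = 0")
  case False
  then have "{x. t < s * x} = {t / s<..}" using assms by (auto simp: field_simps)
  with False assms show ?thesis by (simp add: normal_tail_def)
qed (use assms in simp)

text \<open>Conditioning on the scale: the product measure of the event is the integral over s of
  the normal measures of its sections.\<close>

lemma measure_prod_std_normal_greaterThan:
  assumes "real_distribution \<mu>" and nonneg: "AE s in \<mu>. 0 \<le> s" and "0 < t"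
  shows "measure (distr (\<mu> \<Otimes>\<^sub>M std_normal) borel (\<lambda>p. fst p * snd p)) {t<..}
       = (\<integral>s. indicator {0<..} s * normal_tail (t / s) \<partial>\<mu>)"
proof -
  interpret real_distribution \<mu> by fact
  let ?A = "{p \<in> space (\<mu> \<Otimes>\<^sub>M std_normal). t < fst p * snd p}"
  have A: "?A \<in> sets (\<mu> \<Otimes>\<^sub>M std_normal)" by measurable
  have "emeasure (distr (\<mu> \<Otimes>\<^sub>M std_normal) borel (\<lambda>p. fst p * snd p)) {t<..} = emeasure (\<mu> \<Otimes>\<^sub>M std_normal) ?A"
    by (subst emeasure_distr) (auto intro!: arg_cong2[where f=emeasure])
  also have "\<dots> = (\<integral>\<^sup>+s. emeasure std_normal (Pair s -` ?A) \<partial>\<mu>)"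
    by (rule std_normal.emeasure_pair_measure_alt[OF A])
  also have "\<dots> = (\<integral>\<^sup>+s. ennreal (indicator {0<..} s * normal_tail (t / s)) \<partial>\<mu>)"
  proof (rule nn_integral_cong_AE)
    show "AE s in \<mu>. emeasure std_normal (Pair s -` ?A) = ennreal (indicator {0<..} s * normal_tail (t / s))"
      using nonneg
    proof eventually_elim
      case (elim s)
      have "Pair s -` ?A = {x. t < s * x}" by (auto simp: space_pair_measure)
      with measure_scaled_std_normal[OF elim \<open>0 < t\<close>] show ?case
        by (simp add: std_normal.emeasure_eq_measure)
    qed
  qed
  also have "\<dots> = ennreal (\<integral>s. indicator {0<..} s * normal_tail (t / s) \<partial>\<mu>)"
    by (intro nn_integral_eq_integral integrable_const_bound[where B=1])
       (auto split: split_indicator simp: normal_tail_nonneg normal_tail_le_1)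
  finally show ?thesis
    unfolding measure_def
    by (simp add: integral_nonneg_AE normal_tail_nonneg)
qed

text \<open>The distribution function equals 1 to the right of 1, and right continuity carries this
  to the point 1 itself. For c < 1, the supremum provides some x > c with F x < 1, so mass remains
  beyond c.\<close>

lemma upper_endpoint_1D:
  assumes "real_distribution \<mu>" and endpoint: "upper_endpoint (cdf \<mu>) = 1"
  shows "AE s in \<mu>. s \<le> 1" and "\<And>c. c < 1 \<Longrightarrow> 0 < measure \<mu> {c<..}"
proof -
  interpret real_distribution \<mu> by fact
  have compl: "measure \<mu> {c<..} = 1 - cdf \<mu> c" for c
    using prob_compl[of "{..c}"] by (simp add: cdf_def Compl_eq_Diff_UNIV[symmetric] Compl_atMost)
  have "cdf \<mu> x = 1" if "1 < x" for x
  proof (rule ccontr)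
    assume "cdf \<mu> x \<noteq> 1"
    then have "cdf \<mu> x < 1" using cdf_bounded_prob[of x] by simp
    then have "ereal x \<le> upper_endpoint (cdf \<mu>)"
      unfolding upper_endpoint_def by (intro Sup_upper) auto
    with endpoint that show False by simp
  qed
  then have "eventually (\<lambda>x. cdf \<mu> x = 1) (at_right 1)"
    using eventually_at_right_less[of "1::real"] by (auto elim: eventually_mono)
  then have "(cdf \<mu> \<longlongrightarrow> 1) (at_right 1)"
    by (rule tendsto_eventually)
  moreover have "(cdf \<mu> \<longlongrightarrow> cdf \<mu> 1) (at_right 1)"
    using cdf_is_right_cont[of 1] by (simp add: continuous_within)
  ultimately have "cdf \<mu> 1 = 1"
    using tendsto_unique trivial_limit_at_right_real by blast
  then have "prob {..1} = 1" by (simp add: cdf_def)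
  then show "AE s in \<mu>. s \<le> 1"
    using AE_in_set_eq_1[of "{..1}"] by simp
  fix c :: real assume "c < 1"
  then have "ereal c < upper_endpoint (cdf \<mu>)" unfolding endpoint by simp
  then obtain x where "c < x" "cdf \<mu> x < 1"
    unfolding upper_endpoint_def less_Sup_iff by auto
  then show "0 < measure \<mu> {c<..}"
    using cdf_nondecreasing[of c x] unfolding compl by linarith
qed

section \<open>Maxima of independent variables and independence of the products\<close>

lemma prob_Max_le:
  assumes "prob_space M" and indep: "prob_space.indep_vars M (\<lambda>_. borel) Y {1..}"
    and law: "\<And>i. 1 \<le> i \<Longrightarrow> distr M borel (Y i) = D" and "1 \<le> (n::nat)"
  shows "measure M {\<omega> \<in> space M. Max ((\<lambda>i. Y i \<omega>) ` {1..n}) \<le> (y::real)} = cdf D y ^ n"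
proof -
  interpret prob_space M by fact
  have rv: "Y i \<in> borel_measurable M" if "1 \<le> i" for i
    using indep that by (auto simp: indep_vars_def)
  have "{\<omega> \<in> space M. Max ((\<lambda>i. Y i \<omega>) ` {1..n}) \<le> y} = (\<Inter>i\<in>{1..n}. Y i -` {..y} \<inter> space M)"
    \<comment> \<open>With a nonempty index set, the maximum is at most y exactly when every term
      is.\<close>
    using \<open>1 \<le> n\<close> by auto
  also have "prob \<dots> = (\<Prod>i\<in>{1..n}. prob (Y i -` {..y} \<inter> space M))"
    using \<open>1 \<le> n\<close> by (intro indep_varsD[OF indep]) auto
  also have "\<dots> = (\<Prod>i\<in>{1..n}. cdf D y)"
  proof (intro prod.cong refl)
    fix i assume "i \<in> {1..n}"
    then show "prob (Y i -` {..y} \<inter> space M) = cdf D y"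
      by (simp add: law[of i, symmetric] cdf_def measure_distr rv)
  qed
  finally show ?thesis by simp
qed

text \<open>Independence passes to functions of disjoint blocks of the family. The blocks {Inl n,
  Inr n} give independence of the products, and the singleton blocks give independence of the two
  factors.\<close>

lemma indep_vars_mult_Inl_Inr:
  fixes Ss Xs :: "'i \<Rightarrow> 'a \<Rightarrow> real"
  assumes "prob_space M"
    and ind: "prob_space.indep_vars M (\<lambda>_. borel) (\<lambda>i. case i of Inl n \<Rightarrow> Ss n | Inr n \<Rightarrow> Xs n) K"
    and K: "\<And>n. n \<in> I \<Longrightarrow> Inl n \<in> K \<and> Inr n \<in> K"
  shows "prob_space.indep_vars M (\<lambda>_. borel) (\<lambda>n \<omega>. Ss n \<omega> * Xs n \<omega>) I"
    and "\<And>n. n \<in> I \<Longrightarrow> prob_space.indep_var M borel (Ss n) borel (Xs n)"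
proof -
  interpret prob_space M by fact
  let ?Z = "\<lambda>i. case i of Inl n \<Rightarrow> Ss n | Inr n \<Rightarrow> Xs n"
  have "indep_vars (\<lambda>n. PiM {Inl n, Inr n} (\<lambda>_. borel)) (\<lambda>n \<omega>. restrict (\<lambda>i. ?Z i \<omega>) {Inl n, Inr n}) I"
    using K by (intro indep_vars_restrict[OF ind]) (auto simp: disjoint_family_on_def)
  then have "indep_vars (\<lambda>_. borel) (\<lambda>n \<omega>. (\<lambda>f. f (Inl n) * f (Inr n)) (restrict (\<lambda>i. ?Z i \<omega>) {Inl n, Inr n})) I"
    by (rule indep_vars_compose2) measurable
  then show "indep_vars (\<lambda>_. borel) (\<lambda>n \<omega>. Ss n \<omega> * Xs n \<omega>) I"
    by simp
  fix n assume "n \<in> I"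
  then have "indep_var (PiM {Inl n} (\<lambda>_. borel)) (\<lambda>\<omega>. restrict (\<lambda>i. ?Z i \<omega>) {Inl n})
                       (PiM {Inr n} (\<lambda>_. borel)) (\<lambda>\<omega>. restrict (\<lambda>i. ?Z i \<omega>) {Inr n})"
    using K by (intro indep_var_restrict[OF ind]) auto
  from indep_var_compose[OF this, of "\<lambda>f. f (Inl n)" borel "\<lambda>f. f (Inr n)" borel]
  show "indep_var borel (Ss n) borel (Xs n)"
    by (simp add: comp_def)
qed

context gaussian_mixture
begin

lemma gumbel_tail_product:
  assumes "AE s in \<mu>. 0 \<le> s"
  shows "gumbel_tail (cdf (distr (\<mu> \<Otimes>\<^sub>M std_normal) borel (\<lambda>p. fst p * snd p))) (mix_tail 0)"
proof -
  interpret pair_prob_space \<mu> std_normal ..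
  let ?D = "distr (\<mu> \<Otimes>\<^sub>M std_normal) borel (\<lambda>p. fst p * snd p)"
  interpret D: real_distribution ?D
    by (intro P.real_distribution_distr) measurable
  \<comment> \<open>This provides the monotonicity, right continuity and limits of the distribution
    function that \<open>gumbel_tail\<close> inherits.\<close>
  interpret D: cdf_distribution ?D ..
  show ?thesis
  proof
    fix t :: real assume t: "0 < t"
    have "mix_tail 0 t = measure ?D {t<..}"
      unfolding mix_tail_def
      by (rule measure_prod_std_normal_greaterThan[symmetric]) (use t assms in \<open>auto intro: real_distribution_axioms\<close>)
    also have "\<dots> = 1 - cdf ?D t"
      using D.prob_compl[of "{..t}"] by (simp add: cdf_def Compl_eq_Diff_UNIV[symmetric] Compl_atMost)
    finally show "cdf ?D t = 1 - mix_tail 0 t" by simp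
    show "0 < mix_tail 0 t" using t by (intro mix_tail_pos) auto
  qed (fact mix_tail_shift ln_mix_tail)+
qed

end

theorem theorem1p1:
  fixes M :: "'a measure"
    and S X :: "'a \<Rightarrow> real"
    and Ss Xs :: "nat \<Rightarrow> 'a \<Rightarrow> real"
    and G :: "real \<Rightarrow> real" and a b :: "nat \<Rightarrow> real"
  assumes "prob_space M"
    and S_rv: "S \<in> borel_measurable M"
    and S_nonneg: "\<forall>\<omega>\<in>space M. S \<omega> \<ge> 0"
    and endpoint: "upper_endpoint (cdf (distr M borel S)) = 1"
    and X_normal: "distributed M lborel X (\<lambda>x. ennreal (std_normal_density x))"
    and SX_indep: "prob_space.indep_var M borel S borel X"
    and Ss_copies: "\<forall>n\<ge>1. distr M borel (Ss n) = distr M borel S"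
    and Xs_normal: "\<forall>n\<ge>1. distributed M lborel (Xs n) (\<lambda>x. ennreal (std_normal_density x))"
    and seq_indep: "prob_space.indep_vars M (\<lambda>_. borel)
                      (\<lambda>i. case i of Inl n \<Rightarrow> Ss n | Inr n \<Rightarrow> Xs n)
                      ({Inl n | n. n \<ge> 1} \<union> {Inr n | n. n \<ge> 1})"
  defines "G \<equiv> cdf (distr M borel (\<lambda>\<omega>. S \<omega> * X \<omega>))"
    and "b \<equiv> (\<lambda>n::nat. gen_inv G (1 - 1 / real n))"
    and "a \<equiv> (\<lambda>n::nat. 1 / b n)"
  shows "((\<lambda>n. SUP x. \<bar>measure M {\<omega> \<in> space M.
              Max ((\<lambda>i. Ss i \<omega> * Xs i \<omega>) ` {1..n}) \<le> a n * x + b n} - Gumbel x\<bar>)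
           \<longlonglongrightarrow> 0) \<and>
         (\<lambda>n. a n / (2 * ln (real n)) powr (-1/2)) \<longlonglongrightarrow> 1"
proof -
  interpret prob_space M by fact
  note [measurable] = S_rv
  define \<mu> where "\<mu> = distr M borel S"
  define D where "D = distr (\<mu> \<Otimes>\<^sub>M std_normal) borel (\<lambda>p. fst p * snd p)"
  have real_\<mu>: "real_distribution \<mu>" unfolding \<mu>_def by simp
  interpret mix: gaussian_mixture \<mu>
    using upper_endpoint_1D[OF real_\<mu> endpoint[folded \<mu>_def]] real_\<mu>
    by (simp add: gaussian_mixture_def gaussian_mixture_axioms_def)
  have nonneg: "AE s in \<mu>. 0 \<le> s"
    unfolding \<mu>_def using S_nonneg by (simp add: AE_distr_iff)
  have D: "distr M borel (\<lambda>\<omega>. S \<omega> * X \<omega>) = D"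
    using distr_indep_mult[OF \<open>prob_space M\<close> SX_indep]
    by (simp add: D_def \<mu>_def distr_std_normal[OF X_normal])
  interpret gumbel_tail G "mix.mix_tail 0"
    using mix.gumbel_tail_product[OF nonneg] unfolding G_def D D_def .
  have prods: "indep_vars (\<lambda>_. borel) (\<lambda>n \<omega>. Ss n \<omega> * Xs n \<omega>) {1..}"
    and pairs: "\<And>n. n \<in> {1..} \<Longrightarrow> indep_var borel (Ss n) borel (Xs n)"
    using indep_vars_mult_Inl_Inr[OF \<open>prob_space M\<close> seq_indep, of "{1..}"] by auto
  have law: "distr M borel (\<lambda>\<omega>. Ss n \<omega> * Xs n \<omega>) = D" if "1 \<le> n" for n
    using that distr_indep_mult[OF \<open>prob_space M\<close> pairs[of n]] Ss_copies Xs_normal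
    by (simp add: D_def \<mu>_def distr_std_normal)
  define F where "F = (\<lambda>n x. measure M {\<omega> \<in> space M.
              Max ((\<lambda>i. Ss i \<omega> * Xs i \<omega>) ` {1..n}) \<le> a n * x + b n})"
  \<comment> \<open>Since a(n) = 1 / b(n), the normalised level is exactly the shifted quantile of
    \<open>power_at_quantile_shift\<close>.\<close>
  have F: "F n x = G (b n + x / b n) ^ n" if "1 \<le> n" for n x
    using prob_Max_le[OF \<open>prob_space M\<close> prods law that, of "a n * x + b n"]
    by (simp add: F_def G_def D a_def add.commute)
  have "(\<lambda>n. SUP x. \<bar>F n x - Gumbel x\<bar>) \<longlonglongrightarrow> 0"
  proof (rule polya_uniform_convergence)
    \<comment> \<open>The level b(n) + x / b(n) increases in x once b(n) is positive, which holds
      for all large n.\<close>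
    show "eventually (\<lambda>n. mono (F n)) sequentially"
      using eventually_ge_at_top[of 1] eventually_quantile_pos
    proof eventually_elim
      case (elim n)
      have "0 \<le> G y" for y unfolding G_def cdf_def by simp
      then show ?case
        using elim unfolding F[OF elim(1)] b_def
        by (intro monoI power_mono monoD[OF mono]) (auto simp: divide_right_mono)
    qed
    show "(\<lambda>n. F n x) \<longlonglongrightarrow> Gumbel x" for x
      using power_at_quantile_shift[of x]
    proof (rule Lim_transform_eventually)
      show "eventually (\<lambda>n. G (quantile n + x / quantile n) ^ n = F n x) sequentially"
        using eventually_ge_at_top[of 1] by eventually_elim (simp add: F b_def)
    qed
  qed (simp_all add: F_def mono_Gumbel continuous_on_Gumbel Gumbel_at_bot Gumbel_at_top)
  moreover have "(\<lambda>n. a n / (2 * ln (real n)) powr (-1/2)) \<longlonglongrightarrow> 1"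
    using quantile_asymp unfolding a_def b_def .
  ultimately show ?thesis unfolding F_def by blast
qed

end
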